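(* Let $\mathcal{P}$ be a well-formed integer program and let $\alpha\in\mathcal{P}$. Let $\alpha'$ be the rule with the same left-hand side, cost and guard as $\alpha$ but with $\mathrm{rhs}(\alpha')\subset\mathrm{rhs}(\alpha)$ (a proper sub-multiset), and let $\mathcal{P}'=\mathcal{P}\cup\{\alpha'\}$. Then $\mathcal{P}'$ is well formed and the processor mapping $\mathcal{P}$ to $\mathcal{P}'$ is sound.
   Context: Fix a finite set $\Sigma$ of function symbols of common arity $k$ containing a start symbol $f_0$, and variables ranging over $\mathbb{Z}$. A rule has the form $f(\vec x)\xrightarrow{c}T\ [\varphi]$ where $\vec x$ is a fixed vector of pairwise different program variables, $f\in\Sigma$, $c$ an arithmetic expression (cost), $T$ a finite multiset of terms $g(t_1,\dots,t_k)$ ($g\in\Sigma$, $t_i$ arithmetic expressions), $\varphi$ a finite conjunction of inequations between arithmetic expressions (guard). An integer program is a finite set of rules in which $f_0$ does not occur on right-hand sides. An integer substitution maps variables of its domain to integers; $\sigma\models\alpha$ means all variables of $\alpha$ are in $\mathrm{dom}(\sigma)$ and $\sigma$ models the guard. A configuration is a finite multiset of terms $f(n_1,\dots,n_k)$, $n_i\in\mathbb{Z}$. $S\xrightarrow{k}_{\mathcal{P}}T$ if there are $s\in S$, a rule $f(\vec x)\xrightarrow{c}Q\ [\varphi]$ in $\mathcal{P}$ and an integer substitution $\sigma$ covering the rule's variables with $f(\vec x)\sigma=s$, $\sigma\models\varphi$, $c\sigma=k$, $T=(S\setminus\{s\})\cup Q\sigma$ (multisets, equality modulo arithmetic); costs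 of sequences are summed. $\mathrm{dh}_{\mathcal{P}}(S)=\sup\{k\mid S\xrightarrow{k}{}^{*}_{\mathcal{P}}T\}$, $\mathrm{rc}_{\mathcal{P}}(n)=\sup\{\mathrm{dh}_{\mathcal{P}}(f_0(\vec n))\mid\vec n\in\mathbb{Z}^k,\sum_i|n_i|\leq n\}$. A rule $\alpha$ is well formed if $t_i\sigma\in\mathbb{Z}$ for all $f(t_1,\dots,t_k)\in\mathrm{rhs}(\alpha)$, all $i$ and all integer $\sigma\models\alpha$; a program is well formed if all its rules are. A processor is a partial function on integer programs; it is sound if $\mathrm{rc}_{\mathcal{P}}(n)\geq\mathrm{rc}_{\mathrm{proc}(\mathcal{P})}(n)$ for all $n\in\mathbb{N}$ and all $\mathcal{P}$ where it is defined. *)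

theory Defs
  imports Complex_Main "HOL-Library.Multiset" "HOL-Library.Extended_Real"
begin

datatype (vars: 'v) aexp =
    Var 'v
  | Num real
  | Add "'v aexp" "'v aexp"
  | Sub "'v aexp" "'v aexp"
  | Mul "'v aexp" "'v aexp"
  | Div "'v aexp" "'v aexp"
  | Pow "'v aexp" "'v aexp"

datatype (ineq_vars: 'v) ineq =
    Less "'v aexp" "'v aexp"
  | LessEq "'v aexp" "'v aexp"
  | Greater "'v aexp" "'v aexp"
  | GreaterEq "'v aexp" "'v aexp"

text \<open>Terms consist of a function symbol and its list of arguments.  The argument vector of
  every left-hand side is the globally fixed list of program variables (called \<open>xs\<close> below),
  so a rule only stores the root symbol of its left-hand side.\<close>

type_synonym ('f, 'v) trm = "'f \<times> 'v aexp list"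

datatype ('f, 'v) rule =
  Rule (lhs: 'f) (cost: "'v aexp") (rhs: "('f, 'v) trm multiset") (guard: "'v ineq list")

type_synonym ('f, 'v) program = "('f, 'v) rule set"

type_synonym 'v subst = "'v \<Rightarrow> int option"

type_synonym 'f config = "('f \<times> int list) multiset"

definition rule_vars :: "'v list \<Rightarrow> ('f, 'v) rule \<Rightarrow> 'v set" where
  "rule_vars xs \<alpha> = set xs \<union> vars (cost \<alpha>)
     \<union> (\<Union>(g, ts)\<in>set_mset (rhs \<alpha>). \<Union>t\<in>set ts. vars t)
     \<union> (\<Union>q\<in>set (guard \<alpha>). ineq_vars q)"

text \<open>Evaluation is partial: \<open>None\<close> results from variables outside the domain of the
  substitution, from division by zero, and from undefined powers.  Intermediate values are real,
  since subexpressions may be non-integral even if all variables are integers.\<close>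

definition lift_opt :: "('a \<Rightarrow> 'a \<Rightarrow> 'a option) \<Rightarrow> 'a option \<Rightarrow> 'a option \<Rightarrow> 'a option" where
  "lift_opt h a b = Option.bind a (\<lambda>x. Option.bind b (h x))"

definition power_opt :: "real \<Rightarrow> real \<Rightarrow> real option" where
  "power_opt a b =
     (if a > 0 then Some (a powr b)
      else if a = 0 then (if b > 0 then Some 0 else if b = 0 then Some 1 else None)
      else if b \<in> \<int> then Some (a powi \<lfloor>b\<rfloor>)
      else None)"

primrec eval :: "'v subst \<Rightarrow> 'v aexp \<Rightarrow> real option" where
  "eval \<sigma> (Var v) = map_option real_of_int (\<sigma> v)"
| "eval \<sigma> (Num r) = Some r"
| "eval \<sigma> (Add a b) = lift_opt (\<lambda>x y. Some (x + y)) (eval \<sigma> a) (eval \<sigma> b)"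
| "eval \<sigma> (Sub a b) = lift_opt (\<lambda>x y. Some (x - y)) (eval \<sigma> a) (eval \<sigma> b)"
| "eval \<sigma> (Mul a b) = lift_opt (\<lambda>x y. Some (x * y)) (eval \<sigma> a) (eval \<sigma> b)"
| "eval \<sigma> (Div a b) =
     lift_opt (\<lambda>x y. if y = 0 then None else Some (x / y)) (eval \<sigma> a) (eval \<sigma> b)"
| "eval \<sigma> (Pow a b) = lift_opt power_opt (eval \<sigma> a) (eval \<sigma> b)"

primrec holds :: "'v subst \<Rightarrow> 'v ineq \<Rightarrow> bool" where
  "holds \<sigma> (Less a b) \<longleftrightarrow> (\<exists>x y. eval \<sigma> a = Some x \<and> eval \<sigma> b = Some y \<and> x < y)"
| "holds \<sigma> (LessEq a b) \<longleftrightarrow> (\<exists>x y. eval \<sigma> a = Some x \<and> eval \<sigma> b = Some y \<and> x \<le> y)"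
| "holds \<sigma> (Greater a b) \<longleftrightarrow> (\<exists>x y. eval \<sigma> a = Some x \<and> eval \<sigma> b = Some y \<and> x > y)"
| "holds \<sigma> (GreaterEq a b) \<longleftrightarrow> (\<exists>x y. eval \<sigma> a = Some x \<and> eval \<sigma> b = Some y \<and> x \<ge> y)"

definition models :: "'v list \<Rightarrow> 'v subst \<Rightarrow> ('f, 'v) rule \<Rightarrow> bool" where
  "models xs \<sigma> \<alpha> \<longleftrightarrow> rule_vars xs \<alpha> \<subseteq> dom \<sigma> \<and> (\<forall>q\<in>set (guard \<alpha>). holds \<sigma> q)"

definition integer_program :: "'f set \<Rightarrow> 'f \<Rightarrow> 'v list \<Rightarrow> ('f, 'v) program \<Rightarrow> bool" where
  "integer_program Sig f0 xs P \<longleftrightarrow> finite P \<and>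
     (\<forall>\<alpha>\<in>P. lhs \<alpha> \<in> Sig \<and>
        (\<forall>(g, ts)\<in>#rhs \<alpha>. g \<in> Sig \<and> g \<noteq> f0 \<and> length ts = length xs))"

definition well_formed_rule :: "'v list \<Rightarrow> ('f, 'v) rule \<Rightarrow> bool" where
  "well_formed_rule xs \<alpha> \<longleftrightarrow>
     (\<forall>\<sigma>. models xs \<sigma> \<alpha> \<longrightarrow>
        (\<forall>(g, ts)\<in>#rhs \<alpha>. \<forall>t\<in>set ts. \<exists>z::int. eval \<sigma> t = Some (real_of_int z)))"

definition well_formed :: "'v list \<Rightarrow> ('f, 'v) program \<Rightarrow> bool" where
  "well_formed xs P \<longleftrightarrow> (\<forall>\<alpha>\<in>P. well_formed_rule xs \<alpha>)"

text \<open>\<open>instance_of \<sigma> Q R\<close>: the instance of the multiset of terms \<open>Q\<close> under \<open>\<sigma>\<close> equals,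
  modulo arithmetic, the configuration \<open>R\<close>.  In particular all arguments evaluate to integers.\<close>

definition instance_of :: "'v subst \<Rightarrow> ('f, 'v) trm multiset \<Rightarrow> 'f config \<Rightarrow> bool" where
  "instance_of \<sigma> Q R \<longleftrightarrow>
     image_mset (\<lambda>(g, ts). (g, map (eval \<sigma>) ts)) Q =
     image_mset (\<lambda>(g, ns). (g, map (\<lambda>n. Some (real_of_int n)) ns)) R"

definition step :: "'v list \<Rightarrow> ('f, 'v) program \<Rightarrow> 'f config \<Rightarrow> real \<Rightarrow> 'f config \<Rightarrow> bool" where
  "step xs P S k T \<longleftrightarrow>
     (\<exists>ns. \<exists>\<alpha>\<in>P. \<exists>\<sigma> R.
        (lhs \<alpha>, ns) \<in># S \<and> map \<sigma> xs = map Some ns \<and> models xs \<sigma> \<alpha> \<and>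
        eval \<sigma> (cost \<alpha>) = Some k \<and> instance_of \<sigma> (rhs \<alpha>) R \<and>
        T = (S - {#(lhs \<alpha>, ns)#}) + R)"

inductive steps :: "'v list \<Rightarrow> ('f, 'v) program \<Rightarrow> 'f config \<Rightarrow> real \<Rightarrow> 'f config \<Rightarrow> bool"
  for xs P where
  refl: "steps xs P S 0 S"
| step: "step xs P S k T \<Longrightarrow> steps xs P T l U \<Longrightarrow> steps xs P S (k + l) U"

definition dh :: "'v list \<Rightarrow> ('f, 'v) program \<Rightarrow> 'f config \<Rightarrow> ereal" where
  "dh xs P S = Sup {ereal k | k T. steps xs P S k T}"

definition rc :: "'f \<Rightarrow> 'v list \<Rightarrow> ('f, 'v) program \<Rightarrow> nat \<Rightarrow> ereal" where
  "rc f0 xs P n =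
     Sup {dh xs P {#(f0, ns)#} | ns. length ns = length xs \<and> (\<Sum>m\<leftarrow>ns. \<bar>m\<bar>) \<le> int n}"

definition processor ::
  "'f set \<Rightarrow> 'f \<Rightarrow> 'v list \<Rightarrow> (('f, 'v) program \<Rightarrow> ('f, 'v) program option) \<Rightarrow> bool" where
  "processor Sig f0 xs proc \<longleftrightarrow>
     (\<forall>P P'. proc P = Some P' \<longrightarrow> integer_program Sig f0 xs P \<and> integer_program Sig f0 xs P')"

definition sound ::
  "'f \<Rightarrow> 'v list \<Rightarrow> (('f, 'v) program \<Rightarrow> ('f, 'v) program option) \<Rightarrow> bool" where
  "sound f0 xs proc \<longleftrightarrow>
     (\<forall>P P'. proc P = Some P' \<longrightarrow> (\<forall>n::nat. rc f0 xs P n \<ge> rc f0 xs P' n))"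

definition partial_deletion ::
  "'f set \<Rightarrow> 'f \<Rightarrow> 'v list \<Rightarrow> ('f, 'v) program \<Rightarrow> ('f, 'v) program \<Rightarrow> bool" where
  "partial_deletion Sig f0 xs P P' \<longleftrightarrow>
     integer_program Sig f0 xs P \<and> well_formed xs P \<and>
     (\<exists>\<alpha>\<in>P. \<exists>\<alpha>'. lhs \<alpha>' = lhs \<alpha> \<and> cost \<alpha>' = cost \<alpha> \<and> guard \<alpha>' = guard \<alpha> \<and>
        rhs \<alpha>' \<subset># rhs \<alpha> \<and> P' = P \<union> {\<alpha>'})"

end

theory Submission imports Defs begin

text \<open>Every step of the shortened rule is simulated by the original rule at the same cost, and the
  terms that are produced in addition never block a later step. The one subtlety is that the deleted
  terms may contain variables that occur nowhere else, so a substitution modelling the shortened rule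
  need not cover the original one; completing it by \<open>0\<close> repairs this without changing the value
  of any expression of the shortened rule. Well-formedness of the original rule then makes the
  additional terms evaluate to integers, so the simulating step exists.\<close>

text \<open>By structural induction: the variables of \<open>e\<close> keep their values, and
  undefinedness through division or powers depends only on those values. Hence the two results agree
  even when they are \<open>None\<close>.\<close>

lemma eval_map_le:
  assumes "\<sigma> \<subseteq>\<^sub>m \<tau>" and "vars e \<subseteq> dom \<sigma>"
  shows "eval \<tau> e = eval \<sigma> e"
  using assms by (induction e) (auto simp: map_le_def)

lemma holds_map_le:
  assumes "\<sigma> \<subseteq>\<^sub>m \<tau>" and "ineq_vars q \<subseteq> dom \<sigma>"
  shows "holds \<tau> q \<longleftrightarrow> holds \<sigma> q"
  using assms by (cases q) (simp_all add: eval_map_le)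

text \<open>Truth of the shared guard carries over from \<open>\<sigma>\<close>, which already
  covers its variables. Coverage of \<alpha> is required separately, because its right-hand side may
  have variables that \<alpha>' lacks.\<close>

lemma models_map_le:
  assumes "models xs \<sigma> \<alpha>'" and "\<sigma> \<subseteq>\<^sub>m \<tau>"
    and "guard \<alpha>' = guard \<alpha>" and "rule_vars xs \<alpha> \<subseteq> dom \<tau>"
  shows "models xs \<tau> \<alpha>"
proof -
  have "ineq_vars q \<subseteq> dom \<sigma>" if "q \<in> set (guard \<alpha>)" for q
    using assms(1,3) that unfolding models_def rule_vars_def by auto
  then show ?thesis
    using assms holds_map_le[OF assms(2)] unfolding models_def by auto
qed

lemma vars_rhs_subset_dom:
  assumes "models xs \<sigma> \<alpha>" and "(g, ts) \<in># rhs \<alpha>" and "t \<in> set ts"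
  shows "vars t \<subseteq> dom \<sigma>"
proof -
  have "vars t \<subseteq> (\<Union>(g, ts)\<in>set_mset (rhs \<alpha>). \<Union>t\<in>set ts. vars t)"
    using assms(2,3) by (intro subsetI UN_I[of "(g, ts)"]) auto
  also have "\<dots> \<subseteq> rule_vars xs \<alpha>"
    unfolding rule_vars_def by (intro le_supI1 le_supI2 order_refl)
  also have "\<dots> \<subseteq> dom \<sigma>"
    using assms(1) unfolding models_def by (rule conjunct1)
  finally show ?thesis .
qed

lemma instance_of_map_le:
  assumes "models xs \<sigma> \<alpha>" and "\<sigma> \<subseteq>\<^sub>m \<tau>" and "instance_of \<sigma> (rhs \<alpha>) R"
  shows "instance_of \<tau> (rhs \<alpha>) R"
proof -
  have "image_mset (\<lambda>(g, ts). (g, map (eval \<tau>) ts)) (rhs \<alpha>) =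
        image_mset (\<lambda>(g, ts). (g, map (eval \<sigma>) ts)) (rhs \<alpha>)"
    by (rule image_mset_cong)
       (auto simp: eval_map_le[OF assms(2)] vars_rhs_subset_dom[OF assms(1)])
  then show ?thesis
    using assms(3) unfolding instance_of_def by simp
qed

lemma instance_of_union:
  "instance_of \<sigma> Q R \<Longrightarrow> instance_of \<sigma> Q' R' \<Longrightarrow> instance_of \<sigma> (Q + Q') (R + R')"
  unfolding instance_of_def by simp

lemma instance_of_exists:
  assumes "\<forall>(g, ts)\<in>#Q. \<forall>t\<in>set ts. \<exists>z::int. eval \<sigma> t = Some (real_of_int z)"
  shows "\<exists>R. instance_of \<sigma> Q R"
proof
  \<comment> \<open>The floor merely turns a real value into an \<open>int\<close>; it is exact,
    since every argument evaluates to an integer.\<close>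
  show "instance_of \<sigma> Q (image_mset (\<lambda>(g, ts). (g, map (\<lambda>t. \<lfloor>the (eval \<sigma> t)\<rfloor>) ts)) Q)"
    unfolding instance_of_def multiset.map_comp
    by (rule image_mset_cong) (use assms in fastforce)
qed

text \<open>The completed substitution is total, so it covers every rule; any integer would serve as
  the default value.\<close>

lemma models_completion:
  assumes "models xs \<sigma> \<alpha>'" and "guard \<alpha>' = guard \<alpha>"
  shows "models xs ((\<lambda>_. Some 0) ++ \<sigma>) \<alpha>"
  by (rule models_map_le[OF assms(1) _ assms(2)]) (auto simp: map_le_def)

text \<open>Well-formedness of \<alpha> speaks only about substitutions covering \<alpha>, so it is
  applied to the completion. The integrality obtained there returns to \<open>\<sigma>\<close>,
  which covers the terms that remain.\<close>

lemma well_formed_rule_sub_rhs: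
  assumes "well_formed_rule xs \<alpha>" and "guard \<alpha>' = guard \<alpha>" and "rhs \<alpha>' \<subseteq># rhs \<alpha>"
  shows "well_formed_rule xs \<alpha>'"
  unfolding well_formed_rule_def
proof (clarify)
  fix \<sigma> g ts t
  assume \<sigma>: "models xs \<sigma> \<alpha>'" and g: "(g, ts) \<in># rhs \<alpha>'" and t: "t \<in> set ts"
  let ?\<tau> = "(\<lambda>_. Some 0) ++ \<sigma>"
  have "eval ?\<tau> t = eval \<sigma> t"
    using eval_map_le[of \<sigma> ?\<tau>] vars_rhs_subset_dom[OF \<sigma> g t] by simp
  moreover have "\<exists>z::int. eval ?\<tau> t = Some (real_of_int z)"
    using assms(1) models_completion[OF \<sigma> assms(2)] mset_subset_eqD[OF assms(3) g] t
    unfolding well_formed_rule_def by blast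
  ultimately show "\<exists>z::int. eval \<sigma> t = Some (real_of_int z)"
    by simp
qed

text \<open>The same term is rewritten by the same rule and substitution; the surplus terms of
  \<open>S'\<close> are carried along.\<close>

lemma step_mono_config:
  assumes "step xs P S k T" and "S \<subseteq># S'"
  shows "\<exists>T'. step xs P S' k T' \<and> T \<subseteq># T'"
proof -
  obtain ns \<alpha> \<sigma> R where *: "\<alpha> \<in> P" "(lhs \<alpha>, ns) \<in># S" "map \<sigma> xs = map Some ns"
      "models xs \<sigma> \<alpha>" "eval \<sigma> (cost \<alpha>) = Some k" "instance_of \<sigma> (rhs \<alpha>) R"
      and T: "T = S - {#(lhs \<alpha>, ns)#} + R"
    using assms(1) unfolding step_def by blast
  have "step xs P S' k (S' - {#(lhs \<alpha>, ns)#} + R)"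
    unfolding step_def using * mset_subset_eqD[OF assms(2)] by blast
  \<comment> \<open>Compared count by count: removing one copy is truncated subtraction, which is
    monotone.\<close>
  moreover have "T \<subseteq># S' - {#(lhs \<alpha>, ns)#} + R"
    unfolding T using assms(2) by (simp add: subseteq_mset_def diff_le_mono)
  ultimately show ?thesis by blast
qed

lemma step_simulation:
  assumes wf: "well_formed_rule xs \<alpha>" and "\<alpha> \<in> P"
    and eq: "lhs \<alpha>' = lhs \<alpha>" "cost \<alpha>' = cost \<alpha>" "guard \<alpha>' = guard \<alpha>"
    and sub: "rhs \<alpha>' \<subseteq># rhs \<alpha>"
    and "step xs (insert \<alpha>' P) S k T"
  shows "\<exists>T'. step xs P S k T' \<and> T \<subseteq># T'"
proof -
  obtain ns \<beta> \<sigma> R where \<beta>: "\<beta> \<in> insert \<alpha>' P" "(lhs \<beta>, ns) \<in># S" "map \<sigma> xs = map Some ns"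
      "models xs \<sigma> \<beta>" "eval \<sigma> (cost \<beta>) = Some k" "instance_of \<sigma> (rhs \<beta>) R"
      and T: "T = S - {#(lhs \<beta>, ns)#} + R"
    using assms(7) unfolding step_def by blast
  show ?thesis
  proof (cases "\<beta> = \<alpha>'")
    case False
    with \<beta> T have "step xs P S k T"
      unfolding step_def by blast
    then show ?thesis by blast
  next
    case True
    let ?\<tau> = "(\<lambda>_. Some 0) ++ \<sigma>"
    have le: "\<sigma> \<subseteq>\<^sub>m ?\<tau>" by simp
    have \<sigma>: "models xs \<sigma> \<alpha>'" using \<beta> True by simp
    then have dom: "set xs \<subseteq> dom \<sigma>" "vars (cost \<alpha>') \<subseteq> dom \<sigma>"
      unfolding models_def rule_vars_def by auto
    have \<tau>: "models xs ?\<tau> \<alpha>" by (rule models_completion[OF \<sigma> eq(3)])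
    \<comment> \<open>\<open>\<sigma>\<close> covers the program variables, so the default value
      never reaches the left-hand side and the same term of \<open>S\<close> is rewritten.\<close>
    have "map ?\<tau> xs = map \<sigma> xs"
      using dom(1) le by (auto simp: map_le_def)
    then have args: "map ?\<tau> xs = map Some ns" using \<beta> by simp
    have cost: "eval ?\<tau> (cost \<alpha>) = Some k"
      using eval_map_le[OF le dom(2)] \<beta> True eq by simp
    have "\<forall>(g, ts)\<in>#rhs \<alpha> - rhs \<alpha>'. \<forall>t\<in>set ts. \<exists>z::int. eval ?\<tau> t = Some (real_of_int z)"
      using wf \<tau> unfolding well_formed_rule_def by (blast dest: in_diffD)
    \<comment> \<open>\<open>D\<close> is the instance of the deleted terms, that is, the surplus by
      which the simulating step exceeds \<open>T\<close>.\<close>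
    then obtain D where D: "instance_of ?\<tau> (rhs \<alpha> - rhs \<alpha>') D"
      using instance_of_exists by blast
    have "instance_of ?\<tau> (rhs \<alpha>') R"
      using instance_of_map_le[OF \<sigma> le] \<beta> True by simp
    from instance_of_union[OF this D] have "instance_of ?\<tau> (rhs \<alpha>) (R + D)"
      using sub by simp
    then have "step xs P S k (S - {#(lhs \<alpha>, ns)#} + (R + D))"
      unfolding step_def using \<open>\<alpha> \<in> P\<close> \<beta>(2) True eq(1) args \<tau> cost by force
    moreover have "T \<subseteq># S - {#(lhs \<alpha>, ns)#} + (R + D)"
      unfolding T using True eq(1) by simp
    ultimately show ?thesis by blast
  qed
qed

text \<open>Each simulating step may leave surplus terms, so the induction must allow an arbitrary
  larger start \<open>S'\<close>. The final configurations need no comparison, as only the total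
  cost matters.\<close>

lemma steps_simulation:
  assumes sim: "\<And>S k T. step xs P' S k T \<Longrightarrow> \<exists>T'. step xs P S k T' \<and> T \<subseteq># T'"
    and "steps xs P' S k T" and "S \<subseteq># S'"
  shows "\<exists>T'. steps xs P S' k T'"
  using assms(2,3)
proof (induction arbitrary: S' rule: steps.induct)
  case (refl S)
  show ?case using steps.refl by blast
next
  case (step S k T l U)
  \<comment> \<open>The step is first simulated from \<open>S\<close> itself, then transferred to
    \<open>S'\<close>; its result \<open>T2\<close> contains \<open>T\<close> and is the new start
    for the induction hypothesis.\<close>
  obtain T1 where T1: "step xs P S k T1" "T \<subseteq># T1"
    using sim[OF step.hyps(1)] by blast
  obtain T2 where T2: "step xs P S' k T2" "T1 \<subseteq># T2"
    using step_mono_config[OF T1(1) step.prems] by blast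
  show ?case
    using step.IH[of T2] T1(2) T2 steps.step subset_mset.order_trans by blast
qed

text \<open>Every cost attainable with \<open>P'\<close> is attainable with \<open>P\<close> from
  the same configuration, so both suprema can only grow.\<close>

lemma rc_mono_simulation:
  assumes "\<And>S k T. step xs P' S k T \<Longrightarrow> \<exists>T'. step xs P S k T' \<and> T \<subseteq># T'"
  shows "rc f0 xs P' n \<le> rc f0 xs P n"
proof -
  have "dh xs P' S \<le> dh xs P S" for S
    unfolding dh_def
    by (rule Sup_subset_mono) (use steps_simulation[OF assms] in blast)
  then show ?thesis
    unfolding rc_def by (intro Sup_mono) blast
qed

lemma partial_deletionE:
  assumes "partial_deletion Sig f0 xs P P'"
  obtains \<alpha> \<alpha>' where "integer_program Sig f0 xs P" "\<And>\<beta>. \<beta> \<in> P \<Longrightarrow> well_formed_rule xs \<beta>"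
    "\<alpha> \<in> P" "lhs \<alpha>' = lhs \<alpha>" "cost \<alpha>' = cost \<alpha>" "guard \<alpha>' = guard \<alpha>"
    "rhs \<alpha>' \<subseteq># rhs \<alpha>" "P' = insert \<alpha>' P"
  using assms unfolding partial_deletion_def well_formed_def by (auto simp: subset_mset.less_le)

lemma partial_deletion_integer_program:
  assumes "partial_deletion Sig f0 xs P P'"
  shows "integer_program Sig f0 xs P'"
  using assms
proof (rule partial_deletionE)
  fix \<alpha> \<alpha>'
  assume P: "integer_program Sig f0 xs P" and "\<alpha> \<in> P" and lhs: "lhs \<alpha>' = lhs \<alpha>"
    and sub: "rhs \<alpha>' \<subseteq># rhs \<alpha>" and P': "P' = insert \<alpha>' P"
  then have "lhs \<alpha> \<in> Sig"
    and "\<forall>(g, ts)\<in>#rhs \<alpha>. g \<in> Sig \<and> g \<noteq> f0 \<and> length ts = length xs"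
    unfolding integer_program_def by blast+
  then have "\<forall>(g, ts)\<in>#rhs \<alpha>'. g \<in> Sig \<and> g \<noteq> f0 \<and> length ts = length xs"
    using mset_subset_eqD[OF sub] by blast
  then show ?thesis
    using P \<open>lhs \<alpha> \<in> Sig\<close> lhs unfolding integer_program_def P' by simp
qed

lemma partial_deletion_well_formed:
  assumes "partial_deletion Sig f0 xs P P'"
  shows "well_formed xs P'"
  using assms
proof (rule partial_deletionE)
  fix \<alpha> \<alpha>'
  assume wf: "\<And>\<beta>. \<beta> \<in> P \<Longrightarrow> well_formed_rule xs \<beta>" and "\<alpha> \<in> P"
    and "guard \<alpha>' = guard \<alpha>" "rhs \<alpha>' \<subseteq># rhs \<alpha>" and P': "P' = insert \<alpha>' P"
  then have "well_formed_rule xs \<alpha>'"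
    using well_formed_rule_sub_rhs[OF wf] by blast
  with wf show ?thesis
    unfolding well_formed_def P' by blast
qed

lemma partial_deletion_rc:
  assumes "partial_deletion Sig f0 xs P P'"
  shows "rc f0 xs P' n \<le> rc f0 xs P n"
  using assms
proof (rule partial_deletionE)
  fix \<alpha> \<alpha>'
  assume wf: "\<And>\<beta>. \<beta> \<in> P \<Longrightarrow> well_formed_rule xs \<beta>"
    and *: "\<alpha> \<in> P" "lhs \<alpha>' = lhs \<alpha>" "cost \<alpha>' = cost \<alpha>" "guard \<alpha>' = guard \<alpha>"
      "rhs \<alpha>' \<subseteq># rhs \<alpha>" and P': "P' = insert \<alpha>' P"
  show ?thesis
    unfolding P' using step_simulation[OF wf[OF *(1)] *] by (rule rc_mono_simulation)
qed

theorem theorem4p7: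
  fixes Sig :: "'f set" and f0 :: 'f and xs :: "'v list"
  assumes "finite Sig" and "f0 \<in> Sig" and "distinct xs"
  shows "(\<forall>P P'. partial_deletion Sig f0 xs P P' \<longrightarrow>
            integer_program Sig f0 xs P' \<and> well_formed xs P') \<and>
         (\<forall>proc. (\<forall>P P'. proc P = Some P' \<longrightarrow> partial_deletion Sig f0 xs P P') \<longrightarrow>
            processor Sig f0 xs proc \<and> sound f0 xs proc)"
proof (intro conjI allI impI)
  fix P P' :: "('f, 'v) program"
  assume "partial_deletion Sig f0 xs P P'"
  then show "integer_program Sig f0 xs P'" and "well_formed xs P'"
    by (simp_all add: partial_deletion_integer_program partial_deletion_well_formed)
next
  fix proc :: "('f, 'v) program \<Rightarrow> ('f, 'v) program option"
  assume proc: "\<forall>P P'. proc P = Some P' \<longrightarrow> partial_deletion Sig f0 xs P P'"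
  have "integer_program Sig f0 xs P \<and> integer_program Sig f0 xs P'"
    if "proc P = Some P'" for P P'
  proof
    have del: "partial_deletion Sig f0 xs P P'" using proc that by blast
    then show "integer_program Sig f0 xs P" by (rule partial_deletionE)
    show "integer_program Sig f0 xs P'" using del by (rule partial_deletion_integer_program)
  qed
  then show "processor Sig f0 xs proc"
    unfolding processor_def by blast
  show "sound f0 xs proc"
    unfolding sound_def using proc by (auto intro: partial_deletion_rc)
qed

end
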